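(* Let $I \subset \widetilde{I} \subset \mathbb{R}$ be intervals containing $1$ as an interior point. Suppose $\widetilde{I} \cap (0,\infty)$ is open, $\pm \sup \widetilde{I} \notin \widetilde{I}$, and let $n \geq 3$. Then the following are equivalent for a function $K : \widetilde{I} \to \mathbb{R}$ which is Lebesgue measurable on $I$. (1) $K \not\equiv 0$ on $\widetilde{I}$ and $K[A] := (K(a_{ij}))_{i,j=1}^n \in \mathbb{P}_n^1(\mathbb{R})$ for all $A = (a_{ij})_{i,j=1}^n \in \mathbb{P}_n^1(\widetilde{I})$. (2) $K(1) \neq 0$ and $K[A] \in \mathbb{P}_n^1(\mathbb{R})$ for all $A \in \mathbb{P}_n^1(\widetilde{I})$. (3) Either $K$ is a positive constant, or $K$ is a positive scalar multiple of $\phi_\alpha$ or $\psi_\alpha$ on $\widetilde{I}$ for some $\alpha \in \mathbb{R}$. Moreover, the distinct maps among $\{\phi_\alpha, \psi_\alpha : \alpha \in \mathbb{R}\}$ and the constant map $K \equiv 1$ are linearly independent on $\widetilde{I}$.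
   Context: For $S \subset \mathbb{C}$ and integers $1 \leq k \leq n$, $\mathbb{P}_n^k(S)$ denotes the set of $n \times n$ Hermitian positive semidefinite matrices with all entries in $S$ and rank at most $k$. For $\alpha \in \mathbb{R}$, define $\phi_\alpha, \psi_\alpha : \mathbb{R} \to \mathbb{R}$ by $\phi_\alpha(x) := |x|^\alpha$ and $\psi_\alpha(x) := \operatorname{sgn}(x)|x|^\alpha$ for $x \neq 0$, and $\phi_\alpha(0) = \psi_\alpha(0) := 0$ (for every $\alpha$, including $\alpha \le 0$). "$K$ is Lebesgue measurable on $I$" means that the restriction $K|_I$ is Lebesgue measurable. The condition $\pm\sup\widetilde I\notin\widetilde I$ means that neither $\sup\widetilde I$ nor $-\sup\widetilde I$ belongs to $\widetilde I$ (automatic if $\sup \widetilde I=\infty$). Intervals may be open, closed, half-open, bounded or unbounded. In the final assertion, maps are regarded as functions on $\widetilde{I}$ (distinctness means distinctness as functions on $\widetilde I$), and linear independence is over $\mathbb{R}$. *)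

theory Defs
  imports "HOL-Analysis.Analysis" "HOL-Library.Function_Algebras"
begin

definition hermitian :: "complex^'n^'n \<Rightarrow> bool" where
  "hermitian A \<longleftrightarrow> (\<forall>i j. A $ j $ i = cnj (A $ i $ j))"

definition pos_semidef :: "complex^'n^'n \<Rightarrow> bool" where
  "pos_semidef A \<longleftrightarrow> hermitian A \<and>
     (\<forall>x::complex^'n. (\<Sum>i\<in>UNIV. cnj (x $ i) * (A *v x) $ i) \<in> \<real>\<^sub>\<ge>\<^sub>0)"

definition psd_rank_le :: "nat \<Rightarrow> complex set \<Rightarrow> (complex^'n^'n) set" where
  "psd_rank_le k S = {A. pos_semidef A \<and> (\<forall>i j. A $ i $ j \<in> S) \<and> rank A \<le> k}"

text \<open>The matrix K[A]. It is only applied to matrices with real entries, for which \<^term>\<open>Re\<close>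
  merely changes the type of the entries.\<close>

definition entrywise :: "(real \<Rightarrow> real) \<Rightarrow> complex^'n^'n \<Rightarrow> complex^'n^'n" where
  "entrywise K A = (\<chi> i j. complex_of_real (K (Re (A $ i $ j))))"

definition phi :: "real \<Rightarrow> real \<Rightarrow> real" where
  "phi \<alpha> x = (if x = 0 then 0 else \<bar>x\<bar> powr \<alpha>)"

definition psi :: "real \<Rightarrow> real \<Rightarrow> real" where
  "psi \<alpha> x = (if x = 0 then 0 else sgn x * \<bar>x\<bar> powr \<alpha>)"

text \<open>A function on \<open>J\<close> is represented by its extension by zero to the real line. This identifies
  the real vector space of functions on \<open>J\<close> with a subspace of the one of all functions
  on the line, and members of a set of such functions are distinct iff they differ on \<open>J\<close>.\<close>

definition on_set :: "real set \<Rightarrow> (real \<Rightarrow> real) \<Rightarrow> real \<Rightarrow> real" where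
  "on_set J f = (\<lambda>x. if x \<in> J then f x else 0)"

definition scale_fun :: "real \<Rightarrow> (real \<Rightarrow> real) \<Rightarrow> real \<Rightarrow> real" where
  "scale_fun c f = (\<lambda>x. c * f x)"

lemma vector_space_scale_fun: "vector_space scale_fun"
  by unfold_locales (auto simp: scale_fun_def fun_eq_iff algebra_simps)

end

theory Submission
  imports Defs
begin

text \<open>
  The real matrices in question are exactly the outer products \<open>v v\<^sup>T\<close>, so \<open>K\<close> preserves them iff
  every family of values \<open>K (v\<^sub>i v\<^sub>j)\<close> factors as \<open>w\<^sub>i w\<^sub>j\<close>. On positive arguments this makes
  \<open>t \<mapsto> ln (K (exp t))\<close> midpoint affine. Measurability bounds it on a subset \<open>E\<close> of large measure of a
  small interval around \<open>1\<close>; as \<open>E\<close> meets \<open>h E\<close> for \<open>h\<close> near \<open>1\<close>, it is bounded near \<open>0\<close> and hence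
  affine, so \<open>K\<close> is a multiple of a power. The vectors \<open>(s, \<surd>y, -\<surd>y)\<close> with \<open>s = x / \<surd>y\<close> give
  \<open>K (-x) K y = K x K (-y)\<close>, so one sign governs all negative arguments, and a nonzero \<open>K 0\<close> forces
  \<open>K\<close> to be constant. The condition on \<open>sup J\<close> ensures that \<open>\<bar>x\<bar> \<in> J\<close> for \<open>x \<in> J\<close>.
\<close>

section \<open>Real positive semidefinite matrices of rank one\<close>

text \<open>A basis of the rows has at most one element, so it lies in some \<open>{b}\<close> and
  every row is a multiple of \<open>b\<close>. The zero matrix, with empty basis, is
  included.\<close>

lemma rank_one_decomposition:
  fixes A :: "'a::field^'n^'m"
  assumes "rank A \<le> 1"
  obtains s :: "'m \<Rightarrow> 'a" and b :: "'a^'n" where "\<And>i j. A $ i $ j = s i * b $ j"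
proof -
  obtain B where B: "B \<subseteq> rows A" "rows A \<subseteq> vec.span B" "card B = vec.dim (rows A)"
    by (rule vec.basis_exists)
  have "rows A = range (\<lambda>i. row i A)"
    by (auto simp: rows_def)
  then have "finite B"
    using B(1) finite_subset by fastforce
  moreover have "card B \<le> Suc 0"
    using B(3) assms by (simp add: row_rank_def_gen)
  ultimately have "\<forall>x\<in>B. \<forall>y\<in>B. x = y"
    by (simp add: card_le_Suc0_iff_eq)
  then obtain b where b: "B \<subseteq> {b}"
    by blast
  have "\<exists>k. row i A = k *s b" for i
  proof -
    have "row i A \<in> vec.span {b}"
    proof (rule subsetD[OF vec.span_mono[OF b]], rule subsetD[OF B(2)])
      show "row i A \<in> rows A"
        unfolding rows_def by blast
    qed
    then show ?thesis
      unfolding vec.span_singleton by blast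
  qed
  then obtain s where s: "\<And>i. row i A = s i *s b"
    by metis
  then have "A $ i $ j = s i * b $ j" for i j
    using s[of i] by (simp add: row_def vec_eq_iff)
  then show thesis
    using that by blast
qed

lemma rank_outer_product_le:
  fixes u :: "'m::finite \<Rightarrow> 'a::field" and w :: "'n::finite \<Rightarrow> 'a"
  shows "rank (\<chi> i j. u i * w j) \<le> 1"
proof -
  have "rows (\<chi> i j. u i * w j) \<subseteq> vec.span {vec_lambda w}"
    by (auto simp: rows_def row_def vec.span_singleton vec_eq_iff)
  then show ?thesis
    using vec.dim_le_card[of _ "{vec_lambda w}"] by (auto simp: row_rank_def_gen)
qed

text \<open>The quadratic form at a complex vector \<open>x\<close> is the squared modulus of the
  sum of \<open>v j * x $ j\<close>.\<close>

lemma outer_product_in_psd_rank_le: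
  fixes v :: "'n::finite \<Rightarrow> real"
  assumes "\<And>i j. complex_of_real (v i * v j) \<in> S"
  shows "(\<chi> i j. complex_of_real (v i * v j)) \<in> psd_rank_le 1 S"
proof -
  have "(\<Sum>i\<in>UNIV. cnj (x $ i) * ((\<chi> i j. complex_of_real (v i * v j)) *v x) $ i)
      = of_real ((cmod (\<Sum>j\<in>UNIV. v j * x $ j))\<^sup>2)" for x :: "complex^'n"
  proof -
    have "(\<Sum>i\<in>UNIV. cnj (x $ i) * ((\<chi> i j. complex_of_real (v i * v j)) *v x) $ i)
       = (\<Sum>i\<in>UNIV. \<Sum>j\<in>UNIV. (v i * cnj (x $ i)) * (v j * x $ j))"
      by (simp add: matrix_vector_mult_def sum_distrib_left mult_ac)
    also have "\<dots> = cnj (\<Sum>i\<in>UNIV. v i * x $ i) * (\<Sum>j\<in>UNIV. v j * x $ j)"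
      by (simp add: sum_product)
    finally show ?thesis
      by (simp only: complex_norm_square mult.commute)
  qed
  then have "pos_semidef (\<chi> i j. complex_of_real (v i * v j))"
    by (simp add: pos_semidef_def hermitian_def mult.commute)
  moreover have "rank (\<chi> i j. complex_of_real (v i * v j)) \<le> 1"
    using rank_outer_product_le[of "\<lambda>i. complex_of_real (v i)" "\<lambda>i. complex_of_real (v i)"] by simp
  ultimately show ?thesis
    using assms by (simp add: psd_rank_le_def)
qed

lemma pos_semidef_diag:
  assumes "pos_semidef A"
  shows "A $ i $ i \<in> \<real>\<^sub>\<ge>\<^sub>0"
proof -
  have "(\<Sum>k\<in>UNIV. cnj (axis i 1 $ k) * (A *v axis i 1) $ k) = A $ i $ i"
  proof -
    have "cnj (axis i 1 $ k) * (A *v axis i 1) $ k = (if k = i then A $ i $ i else 0)" for k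
      by (simp add: matrix_vector_mult_def axis_def if_distrib cong: if_cong)
    then show ?thesis
      by simp
  qed
  with assms show ?thesis
    unfolding pos_semidef_def by (auto dest: spec[of _ "axis i 1"])
qed

text \<open>A nonzero such matrix has a nonzero diagonal entry \<open>a\<close>, positive by
  semidefiniteness; the column through it, divided by \<open>sqrt a\<close>, is the required
  vector.\<close>

lemma real_psd_rank_one_outer_product:
  fixes A :: "complex^'n^'n"
  assumes "A \<in> psd_rank_le 1 S" "S \<subseteq> \<real>"
  obtains v :: "'n \<Rightarrow> real" where "A = (\<chi> i j. complex_of_real (v i * v j))"
proof -
  have psd: "pos_semidef A" and rank: "rank A \<le> 1" and real: "\<And>i j. A $ i $ j \<in> \<real>"
    using assms by (auto simp: psd_rank_le_def)
  have sym: "A $ j $ i = A $ i $ j" for i j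
  proof -
    have "A $ j $ i = cnj (A $ i $ j)"
      using psd unfolding pos_semidef_def hermitian_def by blast
    then show ?thesis
      using real[of i j] by (simp add: Reals_cnj_iff)
  qed
  obtain s b where sb: "\<And>i j. A $ i $ j = s i * b $ j"
    using rank_one_decomposition[OF rank] by metis
  show thesis
  proof (cases "A = 0")
    case True
    then show thesis
      using that[of "\<lambda>i. 0"] by (simp add: vec_eq_iff)
  next
    case False
    then obtain p q where "A $ p $ q \<noteq> 0"
      by (auto simp: vec_eq_iff)
    \<comment> \<open>The entries at \<open>(p, q)\<close> and \<open>(q, p)\<close> are both
      nonzero, so the factors \<open>s p\<close> and \<open>b p\<close> of the diagonal entry are
      nonzero.\<close>
    then have nz: "A $ p $ p \<noteq> 0"
      using sym[of p q] by (auto simp: sb)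
    define a where "a = Re (A $ p $ p)"
    have "A $ p $ p \<in> \<real>\<^sub>\<ge>\<^sub>0"
      by (rule pos_semidef_diag[OF psd])
    then have a: "A $ p $ p = of_real a" "a > 0"
      using nz by (auto simp: a_def elim!: nonneg_Reals_cases)
    define v where "v i = Re (A $ i $ p) / sqrt a" for i
    have "A $ i $ j = complex_of_real (v i * v j)" for i j
    proof -
      \<comment> \<open>The 2 by 2 minors of a rank-one matrix vanish; symmetry then replaces row
        \<open>p\<close> by column \<open>p\<close>.\<close>
      have "A $ i $ j * A $ p $ p = A $ i $ p * A $ p $ j"
        by (simp add: sb)
      then have "A $ i $ j * of_real a = A $ i $ p * A $ j $ p"
        by (simp add: a sym)
      moreover have "A $ i $ p = of_real (Re (A $ i $ p))" "A $ j $ p = of_real (Re (A $ j $ p))"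
        using real by simp_all
      ultimately have "A $ i $ j * of_real a = of_real (Re (A $ i $ p) * Re (A $ j $ p))"
        by simp
      moreover have "v i * v j * a = Re (A $ i $ p) * Re (A $ j $ p)"
        using \<open>a > 0\<close> by (simp add: v_def)
      ultimately have "A $ i $ j * of_real a = of_real (v i * v j) * of_real a"
        by (simp only: flip: of_real_mult)
      then show ?thesis
        using \<open>a > 0\<close> by simp
    qed
    then show thesis
      using that[of v] by (simp add: vec_eq_iff)
  qed
qed

lemma entrywise_preserves_rank_one_iff:
  fixes J :: "real set"
  shows "(\<forall>A\<in>(psd_rank_le 1 (complex_of_real ` J) :: (complex^'n^'n) set).
            entrywise K A \<in> psd_rank_le 1 \<real>) \<longleftrightarrow>
         (\<forall>v :: 'n \<Rightarrow> real. (\<forall>i j. v i * v j \<in> J) \<longrightarrow> (\<exists>w. \<forall>i j. K (v i * v j) = w i * w j))"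
    (is "?L \<longleftrightarrow> ?R")
proof (intro iffI allI impI ballI)
  fix v :: "'n \<Rightarrow> real"
  assume ?L and v: "\<forall>i j. v i * v j \<in> J"
  have "(\<chi> i j. complex_of_real (v i * v j)) \<in> psd_rank_le 1 (complex_of_real ` J)"
    by (rule outer_product_in_psd_rank_le, rule imageI) (simp add: v)
  with \<open>?L\<close> have "entrywise K (\<chi> i j. complex_of_real (v i * v j)) \<in> psd_rank_le 1 \<real>"
    by (rule bspec)
  then obtain w where
    "entrywise K (\<chi> i j. complex_of_real (v i * v j)) = (\<chi> i j. complex_of_real (w i * w j))"
    by (rule real_psd_rank_one_outer_product) auto
  then have "K (v i * v j) = w i * w j" for i j
    by (simp add: entrywise_def vec_eq_iff flip: of_real_mult)
  then show "\<exists>w. \<forall>i j. K (v i * v j) = w i * w j"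
    by blast
next
  fix A :: "complex^'n^'n"
  assume ?R and A: "A \<in> psd_rank_le 1 (complex_of_real ` J)"
  obtain v where v: "A = (\<chi> i j. complex_of_real (v i * v j))"
    by (rule real_psd_rank_one_outer_product[OF A]) auto
  have "v i * v j \<in> J" for i j
  proof -
    have "A $ i $ j \<in> complex_of_real ` J"
      using A by (simp add: psd_rank_le_def)
    then show ?thesis
      by (auto simp: v simp flip: of_real_mult)
  qed
  with \<open>?R\<close> obtain w where "\<And>i j. K (v i * v j) = w i * w j"
    by metis
  then have "entrywise K A = (\<chi> i j. complex_of_real (w i * w j))"
    by (simp add: entrywise_def v vec_eq_iff flip: of_real_mult)
  then show "entrywise K A \<in> psd_rank_le 1 \<real>"
    using outer_product_in_psd_rank_le[of w \<real>] by simp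
qed

text \<open>What survives of rank-one preservation on the vectors with at most three distinct entries; this is
  where \<open>n \<ge> 3\<close> enters.\<close>

definition triple_multiplicative :: "real set \<Rightarrow> (real \<Rightarrow> real) \<Rightarrow> bool" where
  "triple_multiplicative J K \<longleftrightarrow>
     (\<forall>a b c. {a * a, b * b, c * c, a * b, a * c, b * c} \<subseteq> J \<longrightarrow>
       (\<exists>p q r. K (a * a) = p * p \<and> K (b * b) = q * q \<and> K (c * c) = r * r \<and>
                K (a * b) = p * q \<and> K (a * c) = p * r \<and> K (b * c) = q * r))"

lemma entrywise_preserves_imp_triple_multiplicative:
  assumes "\<forall>A\<in>(psd_rank_le 1 (complex_of_real ` J) :: (complex^'n^'n) set).
            entrywise K A \<in> psd_rank_le 1 \<real>"
    and card: "CARD('n) \<ge> 3"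
  shows "triple_multiplicative J K"
  unfolding triple_multiplicative_def
proof (intro allI impI)
  fix a b c
  assume *: "{a * a, b * b, c * c, a * b, a * c, b * c} \<subseteq> J"
  obtain T where "T \<subseteq> (UNIV :: 'n set)" "card T = 3"
    using card by (metis obtain_subset_with_card_n)
  then obtain x y z :: 'n where d: "x \<noteq> y" "x \<noteq> z" "y \<noteq> z"
    by (auto simp: card_3_iff)
  \<comment> \<open>The entry \<open>c\<close> fills all remaining positions, so products of entries
    of \<open>v\<close> stay among the six listed ones.\<close>
  define v where "v i = (if i = x then a else if i = y then b else c)" for i
  have "\<forall>i j. v i * v j \<in> J"
    using * by (auto simp: v_def mult.commute)
  then obtain w where w: "\<And>i j. K (v i * v j) = w i * w j"
    using assms(1) unfolding entrywise_preserves_rank_one_iff by blast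
  have "v x = a" "v y = b" "v z = c"
    using d by (auto simp: v_def)
  then show "\<exists>p q r. K (a * a) = p * p \<and> K (b * b) = q * q \<and> K (c * c) = r * r \<and>
                K (a * b) = p * q \<and> K (a * c) = p * r \<and> K (b * c) = q * r"
    using w by metis
qed

section \<open>Additive functions and dependence of powers\<close>

text \<open>Subtracting the linear map that agrees with \<open>f\<close> at \<open>d\<close> leaves
  an additive \<open>g\<close> with \<open>g d = 0\<close>. Iterated halving of its bound makes it
  vanish on \<open>{0..d}\<close>, oddness on \<open>{-d..d}\<close>, and scaling by powers of 2 on
  all of \<open>L\<close>.\<close>

lemma bounded_additive_on_imp_linear:
  fixes f :: "real \<Rightarrow> real"
  assumes L: "is_interval L" "0 \<in> L"
    and add: "\<And>s t. s \<in> L \<Longrightarrow> t \<in> L \<Longrightarrow> s + t \<in> L \<Longrightarrow> f (s + t) = f s + f t"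
    and d: "d > 0" "{-d..d} \<subseteq> L"
    and bound: "\<And>t. t \<in> {0..d} \<Longrightarrow> \<bar>f t\<bar> \<le> M"
  obtains \<alpha> where "\<And>t. t \<in> L \<Longrightarrow> f t = \<alpha> * t"
proof -
  define \<alpha> where "\<alpha> = f d / d"
  define g where "g t = f t - \<alpha> * t" for t
  have gadd: "g (s + t) = g s + g t" if "s \<in> L" "t \<in> L" "s + t \<in> L" for s t
    using add[OF that] by (simp add: g_def algebra_simps)
  have gd: "g d = 0"
    using d by (simp add: g_def \<alpha>_def)
  define M' where "M' = M + \<bar>\<alpha>\<bar> * d"
  \<comment> \<open>Doubling \<open>t\<close> or reflecting it to \<open>d - t\<close> halves any bound for \<open>g\<close> on \<open>{0..d}\<close>.\<close>
  have bound': "\<bar>g t\<bar> \<le> M' / 2 ^ k" if "t \<in> {0..d}" for t k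
    using that
  proof (induction k arbitrary: t)
    case 0
    have "\<bar>\<alpha> * t\<bar> \<le> \<bar>\<alpha>\<bar> * d"
      using 0 by (simp add: abs_mult mult_left_mono)
    then show ?case
      using bound[OF 0] by (simp add: g_def M'_def)
  next
    case (Suc k)
    have half: "\<bar>g s\<bar> \<le> M' / 2 ^ Suc k" if s: "0 \<le> s" "s \<le> d / 2" for s
    proof -
      have "g (s + s) = g s + g s"
        by (rule gadd) (use d s in auto)
      then have "2 * \<bar>g s\<bar> = \<bar>g (s + s)\<bar>"
        by simp
      also have "\<dots> \<le> M' / 2 ^ k"
        using Suc.IH[of "s + s"] s by simp
      finally show ?thesis
        by simp
    qed
    show ?case
    proof (cases "t \<le> d / 2")
      case True
      then show ?thesis
        using half Suc.prems by simp
    next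
      case False
      have "g (t + (d - t)) = g t + g (d - t)"
        by (rule gadd) (use d Suc.prems in auto)
      then have "g t = - g (d - t)"
        by (simp add: gd)
      then show ?thesis
        using half[of "d - t"] False Suc.prems by simp
    qed
  qed
  have zero: "g t = 0" if "t \<in> {0..d}" for t
  proof -
    have "(\<lambda>k. M' / 2 ^ k) \<longlonglongrightarrow> 0"
      by (intro LIMSEQ_divide_realpow_zero) simp
    then have "\<bar>g t\<bar> \<le> 0"
      using bound'[OF that] by (intro LIMSEQ_le_const) auto
    then show ?thesis
      by simp
  qed
  have zero': "g t = 0" if "t \<in> {-d..d}" for t
  proof (cases "t \<ge> 0")
    case True
    then show ?thesis
      using zero that by simp
  next
    case False
    have "g (t + - t) = g t + g (- t)"
      by (rule gadd) (use that d in auto)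
    moreover have "g 0 = 0" "g (- t) = 0"
      using zero False that d by auto
    ultimately show ?thesis
      by simp
  qed
  \<comment> \<open>Halving moves a point towards \<open>0\<close> and so stays in the interval
    \<open>L\<close>; enough halvings bring it into \<open>{-d..d}\<close>.\<close>
  have dyadic: "g t = 2 ^ k * g (t / 2 ^ k) \<and> t / 2 ^ k \<in> L" if "t \<in> L" for t k
  proof (induction k)
    case (Suc k)
    define u where "u = t / 2 ^ k"
    have u: "u \<in> L" "g t = 2 ^ k * g u"
      using Suc by (auto simp: u_def)
    have "u / 2 \<in> L"
    proof (cases "u \<ge> 0")
      case True
      then show ?thesis
        using mem_is_interval_1_I[OF L(1) L(2) u(1), of "u / 2"] by auto
    next
      case False
      then show ?thesis
        using mem_is_interval_1_I[OF L(1) u(1) L(2), of "u / 2"] by auto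
    qed
    moreover have "g (u / 2 + u / 2) = g (u / 2) + g (u / 2)"
      by (rule gadd) (use u \<open>u / 2 \<in> L\<close> in auto)
    ultimately show ?case
      using u(2) by (simp add: u_def mult.commute)
  qed (use that in auto)
  have "f t = \<alpha> * t" if "t \<in> L" for t
  proof -
    have "(\<lambda>k. t / 2 ^ k) \<longlonglongrightarrow> 0"
      by (intro LIMSEQ_divide_realpow_zero) simp
    then have "\<forall>\<^sub>F k in sequentially. dist (t / 2 ^ k) 0 < d"
      using d(1) tendstoD by blast
    then obtain k where "dist (t / 2 ^ k) 0 < d"
      by (auto simp: eventually_sequentially)
    then have "g (t / 2 ^ k) = 0"
      unfolding dist_real_def diff_0_right by (intro zero', unfold atLeastAtMost_iff) linarith
    then have "g t = 0"
      using dyadic[OF that, of k] by simp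
    then show ?thesis
      by (simp add: g_def)
  qed
  then show thesis
    using that by blast
qed

lemma powr_sum_eq_0_imp_coeffs_0:
  fixes c :: "real \<Rightarrow> real"
  assumes "finite F" "open U" "U \<noteq> {}" "U \<subseteq> {0<..}"
    and "\<And>x. x \<in> U \<Longrightarrow> (\<Sum>a\<in>F. c a * x powr a) = 0"
  shows "\<forall>a\<in>F. c a = 0"
  using assms(1,5)
proof (induction F arbitrary: c rule: finite_induct)
  case (insert b F)
  \<comment> \<open>The operator \<open>x d/dx - b\<close> annihilates \<open>x\<^sup>b\<close> and multiplies \<open>x\<^sup>a\<close> by \<open>a - b\<close>.\<close>
  have "(\<Sum>a\<in>F. (c a * (a - b)) * x powr a) = 0" if x: "x \<in> U" for x
  proof -
    have "x > 0"
      using x assms by auto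
    let ?f = "\<lambda>x. \<Sum>a\<in>insert b F. c a * x powr a"
    have "(?f has_real_derivative (\<Sum>a\<in>insert b F. c a * (a * x powr (a - 1)))) (at x)"
      by (intro DERIV_sum DERIV_cmult has_real_derivative_powr \<open>x > 0\<close>)
    moreover have "(?f has_real_derivative 0) (at x)"
      by (rule has_field_derivative_transform_within_open[OF DERIV_const[of 0] assms(2) x])
        (use insert.prems in auto)
    ultimately have "(\<Sum>a\<in>insert b F. c a * (a * x powr (a - 1))) = 0"
      by (rule DERIV_unique)
    moreover have "x * (\<Sum>a\<in>insert b F. c a * (a * x powr (a - 1)))
        = (\<Sum>a\<in>insert b F. c a * a * x powr a)"
      using \<open>x > 0\<close> by (simp only: sum_distrib_left) (intro sum.cong refl, simp add: powr_diff)
    ultimately have "(\<Sum>a\<in>insert b F. c a * a * x powr a) - b * ?f x = 0"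
      using insert.prems[OF x] by simp
    moreover have "(\<Sum>a\<in>insert b F. c a * a * x powr a) - b * ?f x
        = (\<Sum>a\<in>insert b F. (c a * (a - b)) * x powr a)"
      by (simp only: sum_distrib_left flip: sum_subtractf) (simp add: algebra_simps)
    ultimately show ?thesis
      using insert.hyps by simp
  qed
  then have "\<forall>a\<in>F. c a * (a - b) = 0"
    by (rule insert.IH)
  then have F: "\<forall>a\<in>F. c a = 0"
    using insert.hyps(2) by auto
  obtain x where "x \<in> U" "x > 0"
    using assms(3,4) by auto
  then have "c b = 0"
    using insert.prems[of x] insert.hyps F by simp
  with F show ?case
    by simp
qed simp

text \<open>A finite subset of the image is parametrized injectively by some \<open>F\<close>, which
  turns a relation among functions into one with coefficients on indices.\<close>

lemma independent_imageI:
  assumes "\<And>F c. finite F \<Longrightarrow> F \<subseteq> X \<Longrightarrow> (\<And>x. (\<Sum>i\<in>F. c i * g i x) = 0) \<Longrightarrow> \<forall>i\<in>F. c i = 0"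
  shows "module.independent scale_fun (g ` X)"
proof -
  interpret vector_space scale_fun
    by (rule vector_space_scale_fun)
  show ?thesis
    unfolding independent_explicit_module
  proof (intro allI impI)
    fix t :: "(real \<Rightarrow> real) set" and u v
    assume "finite t" "t \<subseteq> g ` X" and sum: "(\<Sum>v\<in>t. scale_fun (u v) v) = 0" and "v \<in> t"
    then obtain F where F: "F \<subseteq> X" "inj_on g F" "t = g ` F"
      by (auto simp: subset_image_inj)
    then have fin: "finite F"
      using \<open>finite t\<close> by (simp add: finite_image_iff)
    have "(\<Sum>i\<in>F. u (g i) * g i x) = 0" for x
    proof -
      have "(\<Sum>i\<in>F. u (g i) * g i x) = (\<Sum>v\<in>t. u v * v x)"
        unfolding F(3) sum.reindex[OF F(2)] by simp
      also have "\<dots> = (\<Sum>v\<in>t. scale_fun (u v) v) x"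
        using \<open>finite t\<close> by (induction t rule: finite_induct) (simp_all add: scale_fun_def)
      finally show ?thesis
        by (simp add: sum)
    qed
    then have "\<forall>i\<in>F. u (g i) = 0"
      using assms[OF fin F(1), of "\<lambda>i. u (g i)"] by blast
    then show "u v = 0"
      using F(3) \<open>v \<in> t\<close> by blast
  qed
qed

section \<open>Measurable sets meeting their dilates\<close>

text \<open>If \<open>E\<close> and its dilate were disjoint, their union would have at least twice
  the measure of \<open>E\<close>, hence more than \<open>3 / 2 * (q - p)\<close>. But it lies in
  \<open>{p..h * q}\<close>, whose length \<open>(q - p) + (h - 1) * q\<close> is below that
  bound.\<close>

lemma meets_dilate:
  fixes E :: "real set"
  assumes "E \<in> sets lebesgue" "E \<subseteq> {p..q}" "0 < p" "p < q"
    and big: "measure lebesgue E > 3 / 4 * (q - p)"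
    and h: "1 \<le> h" "(h - 1) * q < (q - p) / 2"
  obtains e where "e \<in> E" "h * e \<in> E"
proof (rule ccontr)
  assume "\<not> thesis"
  then have disj: "E \<inter> (*) h ` E = {}"
    using that by blast
  have E: "E \<in> lmeasurable"
    using assms(1,2) by (meson fmeasurableI2 lmeasurable_interval(1))
  have meas: "measure lebesgue ((*) h ` E) = h * measure lebesgue E"
    using measure_lebesgue_affine[of h 0 E] h by simp
  have sets_hE: "(*) h ` E \<in> sets lebesgue"
  proof -
    have "(*) h ` E = (*\<^sub>R) (inverse h) -` E \<inter> space lebesgue"
      using h(1) by (force simp: field_simps)
    then show ?thesis
      using measurable_sets[OF lebesgue_measurable_scaling assms(1)] by simp
  qed
  have sub: "E \<union> (*) h ` E \<subseteq> {p..h * q}"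
  proof
    fix x
    assume "x \<in> E \<union> (*) h ` E"
    then consider "x \<in> E" | e where "e \<in> E" "x = h * e"
      by blast
    then show "x \<in> {p..h * q}"
    proof cases
      case 1
      then have "p \<le> x" "x \<le> q"
        using assms(2) by auto
      moreover have "q \<le> h * q"
        using h(1) assms by (simp add: mult_le_cancel_right1)
      ultimately show ?thesis
        by simp
    next
      case 2
      then have "p \<le> e" "e \<le> q"
        using assms(2) by auto
      moreover have "1 * p \<le> h * e"
        using h(1) assms \<open>p \<le> e\<close> by (intro mult_mono) auto
      moreover have "h * e \<le> h * q"
        using h(1) \<open>e \<le> q\<close> by (intro mult_left_mono) auto
      ultimately show ?thesis
        using 2 by simp
    qed
  qed
  then have hE: "(*) h ` E \<in> lmeasurable"
    using sets_hE by (intro fmeasurableI2[OF lmeasurable_interval(1)]) auto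
  have "measure lebesgue (E \<union> (*) h ` E) \<le> measure lebesgue {p..h * q}"
    using E hE sub by (intro measure_mono_fmeasurable) auto
  moreover have "q \<le> h * q"
    using h(1) assms by (simp add: mult_le_cancel_right1)
  ultimately have "measure lebesgue (E \<union> (*) h ` E) \<le> h * q - p"
    using assms by simp
  moreover have "measure lebesgue (E \<union> (*) h ` E) = measure lebesgue E + h * measure lebesgue E"
    using measure_Un3[OF E hE] disj meas by simp
  moreover have "1 * measure lebesgue E \<le> h * measure lebesgue E"
    using h(1) by (intro mult_right_mono) auto
  ultimately show False
    using big h(2) by (simp add: algebra_simps)
qed

text \<open>The sets where \<open>|f x| \<le> n\<close> increase to the whole interval, so by
  continuity from below their measures tend to \<open>q - p\<close>.\<close>

lemma borel_measurable_bounded_on_large_subset: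
  fixes f :: "real \<Rightarrow> real"
  assumes f: "f \<in> borel_measurable (lebesgue_on {p..q})" and "p < q"
  obtains E M where "E \<in> sets lebesgue" "E \<subseteq> {p..q}" "\<And>x. x \<in> E \<Longrightarrow> \<bar>f x\<bar> \<le> M"
    "measure lebesgue E > 3 / 4 * (q - p)"
proof -
  define E where "E n = {x \<in> {p..q}. \<bar>f x\<bar> \<le> real n}" for n
  have "{x \<in> space (lebesgue_on {p..q}). \<bar>f x\<bar> \<le> real n} \<in> sets (lebesgue_on {p..q})" for n
    using f by measurable
  then have E: "E n \<in> sets lebesgue" for n
    by (simp add: E_def sets_restrict_space_iff)
  have "(\<Union>n. E n) = {p..q}"
    using real_arch_simple by (auto simp: E_def)
  moreover have "(\<lambda>n. measure lebesgue (E n)) \<longlonglongrightarrow> measure lebesgue (\<Union>n. E n)"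
  proof (rule Lim_measure_incseq)
    show "incseq E"
      by (force simp: incseq_def E_def)
    show "emeasure lebesgue (\<Union>n. E n) \<noteq> \<infinity>"
      using \<open>(\<Union>n. E n) = {p..q}\<close> \<open>p < q\<close> by simp
  qed (use E in auto)
  ultimately have "(\<lambda>n. measure lebesgue (E n)) \<longlonglongrightarrow> q - p"
    using \<open>p < q\<close> by simp
  moreover have "3 / 4 * (q - p) < q - p"
    using \<open>p < q\<close> by simp
  ultimately have "\<forall>\<^sub>F n in sequentially. measure lebesgue (E n) > 3 / 4 * (q - p)"
    by (rule order_tendstoD(1))
  then obtain n where n: "measure lebesgue (E n) > 3 / 4 * (q - p)"
    by (auto simp: eventually_sequentially)
  show thesis
    by (rule that[OF E _ _ n]) (auto simp: E_def)
qed

section \<open>Entrywise rank-one preservers\<close>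

text \<open>Here \<open>abs_mem\<close> records the condition on the supremum of \<open>J\<close> in
  the form in which negative arguments use it.\<close>

locale rank_one_transform =
  fixes J :: "real set" and K :: "real \<Rightarrow> real"
  assumes interval: "is_interval J"
    and one_mem: "1 \<in> J"
    and open_pos: "open (J \<inter> {0<..})"
    and abs_mem: "\<And>x. x \<in> J \<Longrightarrow> x \<noteq> 0 \<Longrightarrow> \<bar>x\<bar> \<in> J"
    and triple: "triple_multiplicative J K"
begin

lemma between: "x \<in> J \<Longrightarrow> y \<in> J \<Longrightarrow> x \<le> z \<Longrightarrow> z \<le> y \<Longrightarrow> z \<in> J"
  using mem_is_interval_1_I[OF interval] by blast

lemma tripleE:
  assumes "a * a \<in> J" "b * b \<in> J" "c * c \<in> J" "a * b \<in> J" "a * c \<in> J" "b * c \<in> J"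
  obtains p q r where "K (a * a) = p * p" "K (b * b) = q * q" "K (c * c) = r * r"
    "K (a * b) = p * q" "K (a * c) = p * r" "K (b * c) = q * r"
proof -
  have "{a * a, b * b, c * c, a * b, a * c, b * c} \<subseteq> J"
    using assms by simp
  then show thesis
    using triple that unfolding triple_multiplicative_def by metis
qed

section \<open>Values at positive, zero and negative arguments\<close>

lemma nonneg:
  assumes "x \<in> J" "0 \<le> x"
  shows "0 \<le> K x"
proof -
  have "sqrt x * sqrt x = x"
    using assms by simp
  then obtain p where "K x = p * p"
    using assms tripleE[of "sqrt x" "sqrt x" "sqrt x"] by metis
  then show ?thesis
    by simp
qed

text \<open>For the vector with entries \<open>sqrt x\<close> and \<open>sqrt y\<close> the values
  are \<open>p * p\<close>, \<open>q * q\<close> and, off the diagonal,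
  \<open>p * q\<close>.\<close>

lemma geometric_mean:
  assumes "x \<in> J" "y \<in> J" "0 < x" "0 < y"
  shows "sqrt x * sqrt y \<in> J" "K (sqrt x * sqrt y) * K (sqrt x * sqrt y) = K x * K y"
proof -
  have sq: "sqrt x * sqrt x = x" "sqrt y * sqrt y = y"
    using assms by auto
  have "min x y \<in> J" "max x y \<in> J"
    using assms by (auto simp: min_def max_def)
  moreover have "min x y \<le> sqrt x * sqrt y"
  proof (cases "x \<le> y")
    case True
    then have "sqrt x * sqrt x \<le> sqrt x * sqrt y"
      using assms by (intro mult_left_mono) auto
    then show ?thesis
      using sq True by simp
  next
    case False
    then have "sqrt y * sqrt y \<le> sqrt x * sqrt y"
      using assms by (intro mult_right_mono) auto
    then show ?thesis
      using sq False by simp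
  qed
  moreover have "sqrt x * sqrt y \<le> max x y"
  proof (cases "x \<le> y")
    case True
    then have "sqrt x * sqrt y \<le> sqrt y * sqrt y"
      using assms by (intro mult_right_mono) auto
    then show ?thesis
      using sq True by simp
  next
    case False
    then have "sqrt x * sqrt y \<le> sqrt x * sqrt x"
      using assms by (intro mult_left_mono) auto
    then show ?thesis
      using sq False by simp
  qed
  ultimately show mem: "sqrt x * sqrt y \<in> J"
    using between by blast
  obtain p q where "K x = p * p" "K y = q * q" "K (sqrt x * sqrt y) = p * q"
    using tripleE[of "sqrt x" "sqrt y" "sqrt y"] sq assms mem by metis
  then show "K (sqrt x * sqrt y) * K (sqrt x * sqrt y) = K x * K y"
    by simp
qed

text \<open>Used with endpoints such as \<open>x * x / y\<close>, chosen so that a given point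
  becomes the mean.\<close>

lemma geometric_mean':
  assumes "x \<in> J" "y \<in> J" "0 < x" "0 < y" "0 < z" "x * y = z * z"
  shows "z \<in> J" "K z * K z = K x * K y"
proof -
  have "sqrt x * sqrt y = z"
    using assms by (simp flip: real_sqrt_mult)
  then show "z \<in> J" "K z * K z = K x * K y"
    using geometric_mean assms by metis+
qed

text \<open>For negative \<open>x\<close>, the vector \<open>(sqrt (- x), - sqrt (- x))\<close> has
  both diagonal products \<open>- x\<close> and off-diagonal product \<open>x\<close>, so
  \<open>K x = p * q\<close> with \<open>p * p = q * q = K (- x)\<close>.\<close>

lemma abs_eq:
  assumes "x \<in> J"
  shows "\<bar>K x\<bar> = \<bar>K \<bar>x\<bar>\<bar>"
proof (cases "x < 0")
  case True
  then have "- x \<in> J"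
    using abs_mem[of x] assms by simp
  moreover have "sqrt (- x) * sqrt (- x) = - x"
    using True by simp
  moreover have "(- sqrt (- x)) * (- sqrt (- x)) = - x"
    using True by simp
  moreover have "sqrt (- x) * (- sqrt (- x)) = x"
    using True by (metis calculation(2) minus_minus mult_minus_right)
  ultimately obtain p q where "K (- x) = p * p" "K (- x) = q * q" "K x = p * q"
    using assms tripleE[of "sqrt (- x)" "- sqrt (- x)" "- sqrt (- x)"] by metis
  then have "(K x)\<^sup>2 = (K (- x))\<^sup>2"
    by (simp add: power2_eq_square)
  then show ?thesis
    using True by (auto simp: power2_eq_iff)
qed (use assms in auto)

text \<open>The vector \<open>(0, sqrt x)\<close> gives \<open>K 0 = p * p = p * q\<close> and
  \<open>K x = q * q\<close>. Hence a nonzero \<open>K 0\<close> equals every value at a positive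
  argument.\<close>

lemma at_zero:
  assumes "0 \<in> J" "x \<in> J" "0 < x"
  shows "K 0 * K 0 = K 0 * K x"
proof -
  have "sqrt x * sqrt x = x" "(0::real) * 0 = 0" "0 * sqrt x = 0" 
    using assms by auto
  then obtain p q where "K 0 = p * p" "K x = q * q" "K 0 = p * q"
    using assms tripleE[of 0 "sqrt x" "sqrt x"] by metis
  then show ?thesis
    by (metis mult.assoc mult.commute)
qed

lemma neg_proportional:
  assumes "- x \<in> J" "- y \<in> J" "0 < x" "0 < y"
  shows "K (- x) * K y = K x * K (- y)"
proof -
  \<comment> \<open>By symmetry \<open>x \<le> y\<close> may be assumed; then the diagonal product
    \<open>s * s = x * x / y\<close> is at most \<open>x\<close> and stays in
    \<open>J\<close>.\<close>
  have *: "K (- x) * K y = K x * K (- y)" if xy: "- x \<in> J" "- y \<in> J" "0 < x" "x \<le> y" for x y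
  proof -
    define s where "s = x / sqrt y"
    have y: "sqrt y * sqrt y = y" "y > 0"
      using that by auto
    have mem: "x \<in> J" "y \<in> J"
      using abs_mem[of "- x"] abs_mem[of "- y"] that by auto
    have "s * s = x * x / y"
      using y by (simp add: s_def)
    also have "\<dots> \<le> x"
      using that y by (simp add: field_simps)
    finally have "s * s \<in> J"
      using between[of "- x" x "s * s"] that mem zero_le_square[of s] by linarith
    moreover have sy: "s * sqrt y = x"
      using y by (simp add: s_def)
    moreover have "s * - sqrt y = - x" "sqrt y * - sqrt y = - y" "- sqrt y * - sqrt y = y"
      using y(1) sy by simp_all
    note products = y(1) sy this
    ultimately obtain p q r where
      "K (s * s) = p * p" "K y = q * q" "K y = r * r" "K x = p * q" "K (- x) = p * r" "K (- y) = q * r"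
      using tripleE[of s "sqrt y" "- sqrt y", unfolded products] mem xy by blast
    \<comment> \<open>Both sides equal \<open>p * q * q * r\<close>.\<close>
    then show ?thesis
      by (simp add: mult_ac)
  qed
  show ?thesis
  proof (cases "x \<le> y")
    case True
    then show ?thesis
      using * assms by blast
  next
    case False
    then have "K (- y) * K x = K y * K (- x)"
      using * assms by simp
    then show ?thesis
      by (simp add: mult.commute)
  qed
qed

lemma ex_pos_nonzero:
  assumes "x \<in> J" "K x \<noteq> 0"
  shows "\<exists>y\<in>J. 0 < y \<and> K y \<noteq> 0"
proof (cases "x = 0")
  case True
  then have "K 0 = K 1"
    using at_zero[of 1] assms one_mem by simp
  then show ?thesis
    using one_mem assms True by (intro bexI[of _ 1]) auto
next
  case False
  then show ?thesis
    using abs_eq[of x] abs_mem[of x] assms by (intro bexI[of _ "\<bar>x\<bar>"]) auto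
qed

text \<open>Both the zeros and the nonzeros of \<open>K\<close> on the positive part of \<open>J\<close> form open sets, because
  \<open>K z * K z = K x * K y\<close> whenever \<open>z\<close> is the geometric mean of \<open>x\<close> and \<open>y\<close>.\<close>

lemma pos_of_nonzero:
  assumes "\<exists>x\<in>J. K x \<noteq> 0" "x \<in> J" "0 < x"
  shows "0 < K x"
proof -
  let ?P = "J \<inter> {0<..}"
  have open_nonzero: "open {x \<in> ?P. K x \<noteq> 0}"
  proof (subst open_subopen, intro ballI)
    fix x
    assume x: "x \<in> {x \<in> ?P. K x \<noteq> 0}"
    \<comment> \<open>For \<open>y\<close> near \<open>x\<close> the partner
      \<open>x * x / y\<close> is also in \<open>?P\<close>, and \<open>x\<close> is the geometric
      mean of the two; a zero at \<open>y\<close> would force one at \<open>x\<close>.\<close>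
    have "continuous_on ?P (\<lambda>y. x * x / y)"
      by (intro continuous_intros) auto
    then have "open (?P \<inter> (\<lambda>y. x * x / y) -` ?P)"
      by (rule continuous_open_preimage[OF _ open_pos open_pos])
    moreover have "x \<in> ?P \<inter> (\<lambda>y. x * x / y) -` ?P"
      using x by simp
    moreover have "?P \<inter> (\<lambda>y. x * x / y) -` ?P \<subseteq> {x \<in> ?P. K x \<noteq> 0}"
    proof
      fix y
      assume y: "y \<in> ?P \<inter> (\<lambda>y. x * x / y) -` ?P"
      then have "K x * K x = K y * K (x * x / y)"
        using x by (intro geometric_mean'(2)) auto
      then show "y \<in> {x \<in> ?P. K x \<noteq> 0}"
        using x y by auto
    qed
    ultimately show "\<exists>T. open T \<and> x \<in> T \<and> T \<subseteq> {x \<in> ?P. K x \<noteq> 0}"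
      by blast
  qed
  have open_zero: "open {x \<in> ?P. K x = 0}"
  proof (subst open_subopen, intro ballI)
    fix x
    assume x: "x \<in> {x \<in> ?P. K x = 0}"
    \<comment> \<open>Now \<open>y\<close> is the mean of \<open>x\<close> and
      \<open>y * y / x\<close>, so the zero at \<open>x\<close> passes to \<open>y\<close>.\<close>
    have "continuous_on ?P (\<lambda>y. y * y / x)"
      using x by (intro continuous_intros) auto
    then have "open (?P \<inter> (\<lambda>y. y * y / x) -` ?P)"
      by (rule continuous_open_preimage[OF _ open_pos open_pos])
    moreover have "x \<in> ?P \<inter> (\<lambda>y. y * y / x) -` ?P"
      using x by simp
    moreover have "?P \<inter> (\<lambda>y. y * y / x) -` ?P \<subseteq> {x \<in> ?P. K x = 0}"
    proof
      fix y
      assume y: "y \<in> ?P \<inter> (\<lambda>y. y * y / x) -` ?P"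
      then have "K y * K y = K x * K (y * y / x)"
        using x by (intro geometric_mean'(2)) auto
      then show "y \<in> {x \<in> ?P. K x = 0}"
        using x y by auto
    qed
    ultimately show "\<exists>T. open T \<and> x \<in> T \<and> T \<subseteq> {x \<in> ?P. K x = 0}"
      by blast
  qed
  have "is_interval ?P"
    using interval by (intro is_interval_Int) auto
  then have "connected ?P"
    by (simp add: is_interval_connected_1)
  moreover have "?P \<subseteq> {x \<in> ?P. K x \<noteq> 0} \<union> {x \<in> ?P. K x = 0}"
    by blast
  moreover have "{x \<in> ?P. K x \<noteq> 0} \<inter> ?P \<noteq> {}"
    using ex_pos_nonzero assms(1) by blast
  ultimately have "{x \<in> ?P. K x = 0} \<inter> ?P = {}"
    using connectedD[OF _ open_nonzero open_zero] by blast
  then have "K x \<noteq> 0"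
    using assms by blast
  then show ?thesis
    using nonneg[of x] assms by simp
qed

section \<open>The power law on positive arguments\<close>

lemma mult_one:
  assumes "x \<in> J" "y \<in> J" "x * y \<in> J" "0 < x" "0 < y"
  shows "K (x * y) * K 1 = K x * K y"
proof -
  have pos: "0 < sqrt (x * y)"
    using assms by simp
  \<comment> \<open>The number \<open>sqrt (x * y)\<close> is the geometric mean of \<open>x\<close>
    and \<open>y\<close>, and also of \<open>x * y\<close> and \<open>1\<close>.\<close>
  have "K (sqrt (x * y)) * K (sqrt (x * y)) = K x * K y"
    using assms pos by (intro geometric_mean'(2)) auto
  moreover have "K (sqrt (x * y)) * K (sqrt (x * y)) = K (x * y) * K 1"
    using assms pos one_mem by (intro geometric_mean'(2)) auto
  ultimately show ?thesis
    by simp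
qed

lemma ln_mult_one:
  assumes mem: "x \<in> J" "y \<in> J" "x * y \<in> J" "0 < x" "0 < y" and "K 1 \<noteq> 0"
  shows "ln (K (x * y)) + ln (K 1) = ln (K x) + ln (K y)"
proof -
  have pos: "0 < K z" if "z \<in> J" "0 < z" for z
    using pos_of_nonzero[OF _ that] assms(6) one_mem by blast
  have "ln (K (x * y)) + ln (K 1) = ln (K (x * y) * K 1)"
    by (rule ln_mult_pos[symmetric]) (use pos one_mem mem in simp_all)
  also have "\<dots> = ln (K x * K y)"
    by (simp only: mult_one[OF mem])
  also have "\<dots> = ln (K x) + ln (K y)"
    by (rule ln_mult_pos) (use pos mem in simp_all)
  finally show ?thesis .
qed

lemma powr_on_pos:
  assumes meas: "K \<in> borel_measurable (lebesgue_on I)" and I: "1 \<in> interior I" "I \<subseteq> J"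
    and nz: "K 1 \<noteq> 0"
  obtains \<alpha> where "\<And>x. x \<in> J \<Longrightarrow> 0 < x \<Longrightarrow> K x = K 1 * x powr \<alpha>"
proof -
  have pos: "0 < K x" if "x \<in> J" "0 < x" for x
    using pos_of_nonzero[OF _ that] nz one_mem by blast
  define L where "L = {t. exp t \<in> J}"
  \<comment> \<open>Subtracting \<open>ln (K 1)\<close> removes the constant term, which makes
    \<open>f\<close> additive on \<open>L\<close>.\<close>
  define f where "f t = ln (K (exp t)) - ln (K 1)" for t
  have add: "f (s + t) = f s + f t" if "s \<in> L" "t \<in> L" "s + t \<in> L" for s t
  proof -
    have mem: "exp s \<in> J" "exp t \<in> J" "exp s * exp t \<in> J"
      using that by (auto simp: L_def exp_add)
    then have "ln (K (exp s * exp t)) + ln (K 1) = ln (K (exp s)) + ln (K (exp t))"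
      using nz by (intro ln_mult_one) simp_all
    then show ?thesis
      by (simp add: f_def exp_add)
  qed
  have L: "is_interval L" "0 \<in> L"
  proof -
    show "is_interval L"
      unfolding is_interval_1 L_def mem_Collect_eq by (blast intro: between exp_le_cancel_iff[THEN iffD2])
  qed (simp add: L_def one_mem)
  obtain e where "e > 0" and e: "ball 1 e \<subseteq> I"
    using I(1) by (meson mem_interior)
  \<comment> \<open>This keeps \<open>{1 - d..1 + d}\<close> inside both \<open>I\<close> and the
    positive reals.\<close>
  define d where "d = min e 1 / 2"
  define p where "p = 1 - d"
  define q where "q = 1 + d"
  have d: "0 < d" "d < 1" "d < e"
    using \<open>e > 0\<close> by (auto simp: d_def min_def)
  then have pq: "0 < p" "p < 1" "1 < q" "p < q"
    by (auto simp: p_def q_def)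
  have sub: "{p..q} \<subseteq> I"
    using d e by (force simp: p_def q_def ball_def dist_real_def)
  have K_pq: "K \<in> borel_measurable (lebesgue_on {p..q})"
    by (rule measurable_restrict_mono[OF meas sub])
  have "(\<lambda>x. ln (K x)) \<in> borel_measurable (lebesgue_on {p..q})"
    using K_pq by measurable
  then obtain E M where E: "E \<in> sets lebesgue" "E \<subseteq> {p..q}"
      "\<And>x. x \<in> E \<Longrightarrow> \<bar>ln (K x)\<bar> \<le> M" "measure lebesgue E > 3 / 4 * (q - p)"
    using borel_measurable_bounded_on_large_subset[OF _ pq(4)] by metis
  \<comment> \<open>The bound \<open>d\<close> keeps \<open>exp t\<close> in \<open>{p..q}\<close>;
    the bound \<open>d / (2 * q)\<close> gives \<open>\<eta> * q \<le> d / 2\<close>, below the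
    \<open>(q - p) / 2 = d\<close> that \<open>meets_dilate\<close> asks for.\<close>
  define \<eta> where "\<eta> = min d (d / (2 * q))"
  have \<eta>: "0 < \<eta>" "\<eta> \<le> d" "\<eta> * q \<le> d / 2"
  proof -
    show "0 < \<eta>" "\<eta> \<le> d"
      using d pq by (auto simp: \<eta>_def)
    have "\<eta> \<le> d / (2 * q)"
      by (simp add: \<eta>_def)
    then show "\<eta> * q \<le> d / 2"
      using pq by (simp add: field_simps)
  qed
  define \<delta> where "\<delta> = ln (1 + \<eta>)"
  have "\<delta> > 0"
    using \<eta> by (simp add: \<delta>_def)
  have bound: "\<bar>f t\<bar> \<le> 2 * M" if "t \<in> {0..\<delta>}" for t
  proof -
    have "exp t \<le> exp \<delta>"
      using that by simp
    also have "exp \<delta> = 1 + \<eta>"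
      using \<eta> by (simp add: \<delta>_def)
    finally have h: "1 \<le> exp t" "exp t \<le> 1 + \<eta>"
      using that by auto
    have "(exp t - 1) * q \<le> \<eta> * q"
      using h pq by (intro mult_right_mono) auto
    also have "\<dots> < (q - p) / 2"
      using \<eta> d by (simp add: p_def q_def)
    finally obtain x where x: "x \<in> E" "exp t * x \<in> E"
      using meets_dilate[OF E(1,2) pq(1,4) E(4) h(1)] by blast
    have "exp t \<in> {p..q}"
      unfolding atLeastAtMost_iff q_def using h \<eta>(2) pq(2) by (intro conjI; linarith)
    then have mem: "exp t \<in> J" "x \<in> J" "exp t * x \<in> J" "0 < x" "0 < exp t * x"
      using x E(2) sub I(2) pq by (auto simp: subset_iff)
    have "ln (K (exp t * x)) + ln (K 1) = ln (K (exp t)) + ln (K x)"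
      using mem nz by (intro ln_mult_one) simp_all
    \<comment> \<open>Both \<open>x\<close> and \<open>exp t * x\<close> lie in \<open>E\<close>, so
      \<open>f t\<close> is a difference of two logarithms bounded by \<open>M\<close>.\<close>
    then have "f t = ln (K (exp t * x)) - ln (K x)"
      by (simp add: f_def)
    then show ?thesis
      using E(3)[OF x(1)] E(3)[OF x(2)] by linarith
  qed
  have "{-\<delta>..\<delta>} \<subseteq> L"
  proof
    fix t
    assume t: "t \<in> {-\<delta>..\<delta>}"
    have "exp t \<le> exp \<delta>"
      using t by simp
    also have "exp \<delta> = 1 + \<eta>"
      using \<eta> by (simp add: \<delta>_def)
    finally have "exp t \<le> q"
      using \<eta> by (simp add: q_def)
    have "p \<le> 1 - \<eta>"
      using \<eta> by (simp add: p_def)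
    also have "1 - \<eta> \<le> 1 / (1 + \<eta>)"
      using \<eta> by (simp add: field_simps)
    also have "1 / (1 + \<eta>) = exp (- \<delta>)"
      using \<eta> by (simp add: \<delta>_def exp_minus field_simps)
    also have "\<dots> \<le> exp t"
      using t by simp
    finally have "exp t \<in> {p..q}"
      using \<open>exp t \<le> q\<close> by (simp only: atLeastAtMost_iff)
    then show "t \<in> L"
      unfolding L_def using sub I(2) by blast
  qed
  then obtain \<alpha> where \<alpha>: "\<And>t. t \<in> L \<Longrightarrow> f t = \<alpha> * t"
    using bounded_additive_on_imp_linear[OF L add \<open>\<delta> > 0\<close> _ bound] by blast
  have "K x = K 1 * x powr \<alpha>" if x: "x \<in> J" "0 < x" for x
  proof -
    have "f (ln x) = \<alpha> * ln x"
      using x by (intro \<alpha>) (simp add: L_def)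
    then have "ln (K x) = ln (K 1) + \<alpha> * ln x"
      using x by (simp add: f_def)
    then have "exp (ln (K x)) = exp (ln (K 1)) * exp (\<alpha> * ln x)"
      by (simp add: exp_add)
    then show ?thesis
      using pos x one_mem by (simp add: powr_def)
  qed
  then show thesis
    using that by blast
qed

text \<open>A nonzero \<open>K 0\<close> forces a constant. Otherwise \<open>abs_eq\<close>
  determines the modulus of \<open>K\<close>, and the sign on the negative part decides between
  \<open>phi\<close> and \<open>psi\<close>.\<close>

lemma classification:
  assumes "K \<in> borel_measurable (lebesgue_on I)" "1 \<in> interior I" "I \<subseteq> J" and nz: "K 1 \<noteq> 0"
  shows "(\<exists>c>0. \<forall>x\<in>J. K x = c) \<or>
    (\<exists>\<alpha>. \<exists>c>0. (\<forall>x\<in>J. K x = c * phi \<alpha> x) \<or> (\<forall>x\<in>J. K x = c * psi \<alpha> x))"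
proof -
  obtain \<alpha> where \<alpha>: "\<And>x. x \<in> J \<Longrightarrow> 0 < x \<Longrightarrow> K x = K 1 * x powr \<alpha>"
    using powr_on_pos[OF assms] by metis
  have pos: "0 < K x" if "x \<in> J" "0 < x" for x
    using pos_of_nonzero[OF _ that] nz one_mem by blast
  then have K1: "0 < K 1"
    using one_mem by simp
  show ?thesis
  proof (cases "0 \<in> J \<and> K 0 \<noteq> 0")
    case True
    have p: "K x = K 0" if "x \<in> J" "0 < x" for x
      using at_zero[OF _ that] True by simp
    \<comment> \<open>The vector \<open>(sqrt (- x), - sqrt (- x), 0)\<close> gives
      \<open>K 0 = c * c = a * c = b * c\<close> with \<open>c\<close> nonzero, so
      \<open>a = b = c\<close> and \<open>K x = a * b = K 0\<close>.\<close>
    have n: "K x = K 0" if x: "x \<in> J" "x < 0" for x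
    proof -
      have "- x \<in> J"
        using abs_mem[of x] x by simp
      moreover have sq: "sqrt (- x) * sqrt (- x) = - x"
        using x by simp
      moreover have "(- sqrt (- x)) * (- sqrt (- x)) = - x" "sqrt (- x) * (- sqrt (- x)) = x"
        using sq by simp_all
      moreover have "(0::real) * 0 = 0" "sqrt (- x) * 0 = 0" "(- sqrt (- x)) * 0 = 0"
        by simp_all
      ultimately obtain a b c where "K (- x) = a * a" "K (- x) = b * b" "K 0 = c * c"
          "K x = a * b" "K 0 = a * c" "K 0 = b * c"
        using x True tripleE[of "sqrt (- x)" "- sqrt (- x)" 0] by metis
      then show ?thesis
        using True by (metis mult_right_cancel mult_zero_right)
    qed
    have "K x = K 1" if "x \<in> J" for x
      using p[OF that] n[OF that] p[OF one_mem] by (cases x "0 :: real" rule: linorder_cases) auto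
    then show ?thesis
      using K1 by blast
  next
    case False
    \<comment> \<open>If \<open>0\<close> is in \<open>J\<close>, then \<open>K 0 = 0\<close>, which
      matches the value of \<open>phi\<close> there.\<close>
    have abs: "K \<bar>x\<bar> = K 1 * phi \<alpha> x" if "x \<in> J" for x
      using that False \<alpha>[of "\<bar>x\<bar>"] abs_mem[of x] by (cases "x = 0") (auto simp: phi_def)
    show ?thesis
    proof (cases "\<forall>x\<in>J. x < 0 \<longrightarrow> K x = K (- x)")
      case True
      then have "K x = K 1 * phi \<alpha> x" if "x \<in> J" for x
        using abs[OF that] that by (cases "x < 0") auto
      then show ?thesis
        using K1 by blast
    next
      case False
      then obtain y where y: "y \<in> J" "y < 0" "K y \<noteq> K (- y)"
        by blast
      \<comment> \<open>Equal moduli and different values force opposite signs at \<open>y\<close>;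
        \<open>neg_proportional\<close> carries this over to every negative argument.\<close>
      then have y': "K y = - K (- y)" "0 < K (- y)"
        using abs_eq[of y] abs_mem[of y] pos[of "- y"] by (auto simp: abs_if split: if_splits)
      have "K x = K 1 * psi \<alpha> x" if x: "x \<in> J" for x
      proof (cases "x < 0")
        case True
        have "K x * K (- y) = K (- x) * K y"
          using neg_proportional[of "- x" "- y"] x y True by simp
        then have "(K x + K (- x)) * K (- y) = 0"
          using y'(1) by (simp add: distrib_right)
        then have "K x = - K (- x)"
          using y'(2) by (simp add: add_eq_0_iff2)
        then show ?thesis
          using abs[OF x] True by (simp add: phi_def psi_def)
      next
        case False
        then show ?thesis
          using abs[OF x] by (simp add: phi_def psi_def sgn_if)
      qed
      then show ?thesis
        using K1 by blast
    qed
  qed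
qed

end

section \<open>Sufficiency of the classified forms\<close>

lemma rank_one_of_classified:
  assumes "(\<exists>c>0. \<forall>x\<in>J. K x = c) \<or>
    (\<exists>\<alpha>. \<exists>c>0. (\<forall>x\<in>J. K x = c * phi \<alpha> x) \<or> (\<forall>x\<in>J. K x = c * psi \<alpha> x))"
    and v: "\<forall>i j. v i * v j \<in> J"
  shows "\<exists>w. \<forall>i j. K (v i * v j) = w i * (w j :: real)"
proof -
  \<comment> \<open>The value 0 at 0 makes both maps multiplicative on the whole line, also for
    nonpositive exponents.\<close>
  have phi_mult: "phi \<alpha> (x * y) = phi \<alpha> x * phi \<alpha> y" for \<alpha> x y
    by (simp add: phi_def abs_mult powr_mult)
  have psi_mult: "psi \<alpha> (x * y) = psi \<alpha> x * psi \<alpha> y" for \<alpha> x y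
    by (simp add: psi_def abs_mult powr_mult sgn_mult)
  consider c where "c > 0" "\<forall>x\<in>J. K x = c"
    | \<alpha> c where "c > 0" "\<forall>x\<in>J. K x = c * phi \<alpha> x"
    | \<alpha> c where "c > 0" "\<forall>x\<in>J. K x = c * psi \<alpha> x"
    using assms(1) by blast
  then show ?thesis
  proof cases
    case 1
    then show ?thesis
      using v by (intro exI[of _ "\<lambda>i. sqrt c"]) simp
  next
    case 2
    then have "K (v i * v j) = (sqrt c * sqrt c) * (phi \<alpha> (v i) * phi \<alpha> (v j))" for i j
      using v by (simp add: phi_mult)
    then show ?thesis
      by (intro exI[of _ "\<lambda>i. sqrt c * phi \<alpha> (v i)"]) (simp only: mult_ac, simp)
  next
    case 3
    then have "K (v i * v j) = (sqrt c * sqrt c) * (psi \<alpha> (v i) * psi \<alpha> (v j))" for i j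
      using v by (simp add: psi_mult)
    then show ?thesis
      by (intro exI[of _ "\<lambda>i. sqrt c * psi \<alpha> (v i)"]) (simp only: mult_ac, simp)
  qed
qed

section \<open>Linear independence of the power maps\<close>

text \<open>Formal names for the maps, so that coefficients can be attached even where two maps
  coincide on \<open>J\<close>.\<close>

primrec power_map :: "(bool \<times> real) option \<Rightarrow> real \<Rightarrow> real" where
  "power_map None = (\<lambda>x. 1)"
| "power_map (Some p) = (if fst p then phi (snd p) else psi (snd p))"

text \<open>Padding the coefficients by zero pairs \<open>phi\<close> and \<open>psi\<close> of
  equal exponent over one common finite set of exponents.\<close>

lemma sum_power_map:
  fixes c :: "(bool \<times> real) option \<Rightarrow> real"
  assumes "finite F"
  defines "G \<equiv> insert 0 (snd ` {p. Some p \<in> F})"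
    and "c' \<equiv> \<lambda>i. if i \<in> F then c i else 0"
  shows "finite G"
    and "(\<Sum>i\<in>F. c i * power_map i x) =
      (\<Sum>a\<in>G. c' (Some (True, a)) * phi a x + c' (Some (False, a)) * psi a x) + c' None"
proof -
  have "{p. Some p \<in> F} = Some -` F"
    by auto
  then show G: "finite G"
    using assms(1) by (simp add: G_def finite_vimageI)
  define H :: "(bool \<times> real) option set" where "H = insert None (Some ` (UNIV \<times> G))"
  have "F \<subseteq> H"
  proof
    fix i
    assume "i \<in> F"
    then show "i \<in> H"
      by (cases i) (force simp: H_def G_def)+
  qed
  have fin: "finite (Some ` (UNIV \<times> G) :: (bool \<times> real) option set)"
    using G by (intro finite_imageI finite_cartesian_product) auto
  have "(\<Sum>i\<in>F. c i * power_map i x) = (\<Sum>i\<in>F. c' i * power_map i x)"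
    by (intro sum.cong) (auto simp: c'_def)
  also have "\<dots> = (\<Sum>i\<in>H. c' i * power_map i x)"
    using fin \<open>F \<subseteq> H\<close> by (intro sum.mono_neutral_left) (auto simp: H_def c'_def)
  also have "\<dots> = c' None + (\<Sum>p\<in>UNIV \<times> G. c' (Some p) * power_map (Some p) x)"
    using fin by (simp add: H_def sum.reindex image_iff)
  also have "(\<Sum>p\<in>UNIV \<times> G. c' (Some p) * power_map (Some p) x) =
      (\<Sum>b\<in>UNIV. \<Sum>a\<in>G. c' (Some (b, a)) * power_map (Some (b, a)) x)"
    by (simp only: sum.cartesian_product split_def prod.collapse)
  also have "\<dots> = (\<Sum>a\<in>G. c' (Some (True, a)) * phi a x + c' (Some (False, a)) * psi a x)"
    by (simp add: UNIV_bool sum.distrib)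
  finally show "(\<Sum>i\<in>F. c i * power_map i x) =
      (\<Sum>a\<in>G. c' (Some (True, a)) * phi a x + c' (Some (False, a)) * psi a x) + c' None"
    by simp
qed

text \<open>The point 0 isolates the coefficient of the constant, positive arguments see only the
  sums of the \<open>phi\<close> and \<open>psi\<close> coefficients of each exponent, negative ones
  only the differences.\<close>

lemma independent_power_maps:
  fixes J :: "real set"
  assumes interval: "is_interval J" and one: "1 \<in> J" and opn: "open (J \<inter> {0<..})"
  shows "module.independent scale_fun (on_set J ` (range phi \<union> range psi \<union> {\<lambda>x. 1}))"
    (is "module.independent _ ?S")
proof -
  define X :: "(bool \<times> real) option set" where "X = {i. (i = None \<longrightarrow> 0 \<in> J) \<and> ((\<exists>a. i = Some (False, a)) \<longrightarrow> (\<exists>x\<in>J. x < 0))}"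
  define g where "g i = on_set J (power_map i)" for i
  have between: "z \<in> J" if "x \<in> J" "y \<in> J" "x \<le> z" "z \<le> y" for x y z
    using that mem_is_interval_1_I[OF interval] by blast
  have zero_mem: "0 \<in> J" if "x \<in> J" "x < 0" for x
    using between[OF that(1) one] that by simp
  \<comment> \<open>\<open>X\<close> indexes the distinct maps: \<open>\<psi>\<^sub>\<alpha>\<close> is omitted if it agrees with \<open>\<phi>\<^sub>\<alpha>\<close> on \<open>J\<close>, and the constant
    if it agrees with \<open>\<phi>\<^sub>0\<close>.\<close>
  have "?S = g ` X"
  proof
    have "on_set J (phi a) \<in> g ` X" for a
      by (rule image_eqI[of _ _ "Some (True, a)"]) (auto simp: g_def X_def)
    moreover have "on_set J (psi a) \<in> g ` X" for a
    proof (cases "\<exists>x\<in>J. x < 0")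
      case True
      then show ?thesis
        by (intro image_eqI[of _ _ "Some (False, a)"]) (auto simp: g_def X_def)
    next
      case False
      then have "on_set J (psi a) = on_set J (phi a)"
        by (force simp: on_set_def phi_def psi_def fun_eq_iff)
      then show ?thesis
        by (intro image_eqI[of _ _ "Some (True, a)"]) (auto simp: g_def X_def)
    qed
    moreover have "on_set J (\<lambda>x. 1) \<in> g ` X"
    proof (cases "0 \<in> J")
      case True
      then show ?thesis
        by (intro image_eqI[of _ _ None]) (auto simp: g_def X_def)
    next
      case False
      then have "on_set J (\<lambda>x. 1) = on_set J (phi 0)"
        by (auto simp: on_set_def phi_def fun_eq_iff)
      then show ?thesis
        by (intro image_eqI[of _ _ "Some (True, 0)"]) (auto simp: g_def X_def)
    qed
    ultimately show "?S \<subseteq> g ` X"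
      by blast
    show "g ` X \<subseteq> ?S"
    proof
      fix f
      assume "f \<in> g ` X"
      then obtain i where "f = on_set J (power_map i)"
        by (auto simp: g_def)
      then show "f \<in> ?S"
        by (cases i) auto
    qed
  qed
  moreover have "module.independent scale_fun (g ` X)"
  proof (rule independent_imageI)
    fix F c
    assume F: "finite F" "F \<subseteq> X" and sum: "\<And>x. (\<Sum>i\<in>F. c i * g i x) = 0"
    define G where "G = insert 0 (snd ` {p. Some p \<in> F})"
    define c' where "c' i = (if i \<in> F then c i else 0)" for i
    let ?p = "\<lambda>a. c' (Some (True, a))" and ?q = "\<lambda>a. c' (Some (False, a))" and ?r = "c' None"
    have G: "finite G" "0 \<in> G"
      using sum_power_map(1)[OF F(1)] by (auto simp: G_def)
    have sum': "(\<Sum>a\<in>G. ?p a * phi a x + ?q a * psi a x) + ?r = 0" if "x \<in> J" for x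
      using sum[of x] sum_power_map(2)[OF F(1), of c x] that
      by (simp add: g_def on_set_def G_def c'_def)
    have r: "?r = 0"
    proof (cases "0 \<in> J")
      case True
      then show ?thesis
        using sum'[of 0] by (simp add: phi_def psi_def)
    next
      case False
      then have "None \<notin> F"
        using F(2) by (auto simp: X_def)
      then show ?thesis
        by (simp add: c'_def)
    qed
    have "(\<Sum>a\<in>G. (?p a + ?q a) * x powr a) = 0" if x: "x \<in> J \<inter> {0<..}" for x
      using sum'[of x] x r by (simp add: phi_def psi_def distrib_right)
    moreover have "1 \<in> J \<inter> {0<..}"
      using one by simp
    ultimately have plus: "?p a + ?q a = 0" if "a \<in> G" for a
      using powr_sum_eq_0_imp_coeffs_0[OF G(1) opn, of "\<lambda>a. ?p a + ?q a"] that by blast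
    have q: "?q a = 0" if a: "a \<in> G" for a
    proof (cases "\<exists>y\<in>J. y < 0")
      case True
      then obtain y where y: "y \<in> J" "y < 0"
        by blast
      \<comment> \<open>Evaluation at \<open>- x\<close>, which lies between \<open>y\<close> and
        \<open>0\<close>, flips the sign of each \<open>psi\<close> term.\<close>
      have "(\<Sum>a\<in>G. (?p a - ?q a) * x powr a) = 0" if x: "x \<in> {0<..<-y}" for x
      proof -
        have "- x \<in> J"
          using between[OF y(1) zero_mem[OF y]] x by simp
        then show ?thesis
          using sum'[of "- x"] x r by (simp add: phi_def psi_def left_diff_distrib)
      qed
      moreover have "open {0<..<-y}" "{0<..<-y} \<noteq> {}" "{0<..<-y} \<subseteq> {0<..}"
        using y by (simp_all add: subset_iff)
      ultimately have "?p a - ?q a = 0"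
        using powr_sum_eq_0_imp_coeffs_0[OF G(1), of "{0<..<-y}" "\<lambda>a. ?p a - ?q a"] a by blast
      then show ?thesis
        using plus[OF a] by simp
    next
      case False
      then have "Some (False, a) \<notin> F"
        using F(2) by (auto simp: X_def)
      then show ?thesis
        by (simp add: c'_def)
    qed
    show "\<forall>i\<in>F. c i = 0"
    proof
      fix i
      assume i: "i \<in> F"
      have "c' i = 0"
      proof (cases i)
        case None
        then show ?thesis
          using r by simp
      next
        case (Some p)
        then have "snd p \<in> G"
          using i by (auto simp: G_def)
        then show ?thesis
          using Some q[of "snd p"] plus[of "snd p"] by (cases p; cases "fst p") auto
      qed
      then show "c i = 0"
        using i by (simp add: c'_def)
    qed
  qed
  ultimately show ?thesis
    by simp
qed

section \<open>Assembling the equivalences and the independence\<close>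

theorem mainTheorem1:
  fixes I J :: "real set"
  assumes "is_interval I" and "is_interval J" and "I \<subseteq> J"
    and "1 \<in> interior I"
    and "open (J \<inter> {0<..})"
    and "bdd_above J \<longrightarrow> Sup J \<notin> J \<and> - Sup J \<notin> J"
    and "CARD('n::finite) \<ge> 3"
  shows
    "(\<forall>K :: real \<Rightarrow> real. K \<in> borel_measurable (lebesgue_on I) \<longrightarrow>
       (let P_J = (psd_rank_le 1 (complex_of_real ` J) :: (complex^'n^'n) set);
            P_R = (psd_rank_le 1 \<real> :: (complex^'n^'n) set);
            stmt1 = ((\<exists>x\<in>J. K x \<noteq> 0) \<and> (\<forall>A\<in>P_J. entrywise K A \<in> P_R));
            stmt2 = (K 1 \<noteq> 0 \<and> (\<forall>A\<in>P_J. entrywise K A \<in> P_R));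
            stmt3 = ((\<exists>c>0. \<forall>x\<in>J. K x = c) \<or>
                     (\<exists>\<alpha>. \<exists>c>0. (\<forall>x\<in>J. K x = c * phi \<alpha> x) \<or> (\<forall>x\<in>J. K x = c * psi \<alpha> x)))
        in (stmt1 \<longleftrightarrow> stmt2) \<and> (stmt2 \<longleftrightarrow> stmt3)))
     \<and> module.independent scale_fun
         (on_set J ` (range phi \<union> range psi \<union> {\<lambda>x. 1}))"
proof (intro conjI allI impI)
  have one: "1 \<in> J"
    using assms(3,4) interior_subset by blast
  have between: "z \<in> J" if "x \<in> J" "y \<in> J" "x \<le> z" "z \<le> y" for x y z
    using that mem_is_interval_1_I[OF assms(2)] by blast
  show "module.independent scale_fun (on_set J ` (range phi \<union> range psi \<union> {\<lambda>x. 1}))"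
    by (rule independent_power_maps[OF assms(2) one assms(5)])
  have abs_mem: "\<bar>x\<bar> \<in> J" if x: "x \<in> J" "x \<noteq> 0" for x
  proof (cases "x < 0")
    case True
    \<comment> \<open>A point of \<open>J\<close> at or beyond \<open>- x\<close> suffices, since
      \<open>x < - x\<close>. In the bounded case, \<open>x \<le> - Sup J\<close> would place
      \<open>- Sup J\<close> between \<open>x\<close> and \<open>1\<close>, hence in
      \<open>J\<close>; so \<open>- x < Sup J\<close>.\<close>
    have "\<exists>y\<in>J. - x \<le> y"
    proof (cases "bdd_above J")
      case True
      then have "- Sup J < x"
      proof (rule_tac ccontr)
        assume "\<not> - Sup J < x"
        moreover have "1 \<le> Sup J"
          using cSup_upper[OF one True] .
        ultimately have "- Sup J \<in> J"
          using between[OF x(1) one] by simp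
        then show False
          using assms(6) True by blast
      qed
      then show ?thesis
        using less_cSupD[of J "- x"] one by (metis empty_iff less_imp_le minus_less_iff)
    next
      case False
      then show ?thesis
        by (meson bdd_aboveI linear)
    qed
    then obtain y where "y \<in> J" "- x \<le> y"
      by blast
    then show ?thesis
      using between[OF x(1), of y "- x"] True by simp
  qed (use x in simp)
  fix K :: "real \<Rightarrow> real"
  assume meas: "K \<in> borel_measurable (lebesgue_on I)"
  define pres where "pres \<longleftrightarrow> (\<forall>A\<in>(psd_rank_le 1 (complex_of_real ` J) :: (complex^'n^'n) set).
    entrywise K A \<in> psd_rank_le 1 \<real>)"
  define classified where "classified \<longleftrightarrow> (\<exists>c>0. \<forall>x\<in>J. K x = c) \<or>
    (\<exists>\<alpha>. \<exists>c>0. (\<forall>x\<in>J. K x = c * phi \<alpha> x) \<or> (\<forall>x\<in>J. K x = c * psi \<alpha> x))"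
  have transform: "rank_one_transform J K" if pres
  proof
    show "triple_multiplicative J K"
      using entrywise_preserves_imp_triple_multiplicative that assms(7) unfolding pres_def by blast
  qed (use assms(2,5) one abs_mem in auto)
  have 12: "K 1 \<noteq> 0" if "\<exists>x\<in>J. K x \<noteq> 0" pres
    using rank_one_transform.pos_of_nonzero[OF transform[OF that(2)] that(1) one] by simp
  have 23: classified if "K 1 \<noteq> 0" pres
    unfolding classified_def
    using rank_one_transform.classification[OF transform[OF that(2)] meas assms(4,3) that(1)] .
  have 3: pres if classified
    unfolding pres_def entrywise_preserves_rank_one_iff
    using rank_one_of_classified[OF that[unfolded classified_def]] by blast
  \<comment> \<open>Both \<open>phi\<close> and \<open>psi\<close> take the value 1 at 1, so
    \<open>K 1\<close> is the positive factor \<open>c\<close>.\<close>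
  have 4: "K 1 \<noteq> 0" if classified
    using that one by (auto simp: classified_def phi_def psi_def)
  show "let P_J = (psd_rank_le 1 (complex_of_real ` J) :: (complex^'n^'n) set);
            P_R = (psd_rank_le 1 \<real> :: (complex^'n^'n) set);
            stmt1 = ((\<exists>x\<in>J. K x \<noteq> 0) \<and> (\<forall>A\<in>P_J. entrywise K A \<in> P_R));
            stmt2 = (K 1 \<noteq> 0 \<and> (\<forall>A\<in>P_J. entrywise K A \<in> P_R));
            stmt3 = ((\<exists>c>0. \<forall>x\<in>J. K x = c) \<or>
                     (\<exists>\<alpha>. \<exists>c>0. (\<forall>x\<in>J. K x = c * phi \<alpha> x) \<or> (\<forall>x\<in>J. K x = c * psi \<alpha> x)))
        in (stmt1 \<longleftrightarrow> stmt2) \<and> (stmt2 \<longleftrightarrow> stmt3)"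
    unfolding Let_def pres_def[symmetric] classified_def[symmetric]
    using 12 23 3 4 one by blast
qed

end
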